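(* For integers $n,b\geq1$ and $k\geq1$, the number of $(n,b)$-$k$-omino towers is $\binom{kn-1}{n-b}$.
   Context: Fix an integer $k\ge1$. A $k$-omino block is a horizontal $k\times1$ rectangle occupying cells $(x,y),\dots,(x+k-1,y)$ of the integer grid; $y$ is its level and $\{x,\dots,x+k-1\}$ its column set. For integers $n\ge b\ge1$, an $(n,b)$-$k$-omino tower is a finite set of $n$ pairwise non-overlapping horizontal $k$-omino blocks such that: (i) exactly $b$ of them (the base) lie at level $0$, occupying a contiguous horizontal run of $bk$ cells; (ii) the other $n-b$ blocks lie at levels $\ge1$, and every such block at columns $\{x,\dots,x+k-1\}$ and level $y$ has a block at level $y-1$ in one of the $2k-1$ positions from $\{x-k+1,\dots,x\}$ to $\{x+k-1,\dots,x+2k-2\}$ (i.e. whose column set meets $\{x,\dots,x+k-1\}$). Towers are fixed polyominoes, considered up to horizontal translation. If $b>n$ there are no such towers, consistent with $\binom{kn-1}{n-b}=0$ for $n-b<0$. *)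

theory Defs
  imports Main
begin

text \<open>
  A block is represented by its leftmost cell \<open>(x, y)\<close>, so \<open>y\<close> is its level. For \<open>k \<ge> 1\<close> this is a
  faithful encoding of the \<open>k \<times> 1\<close> rectangle.
\<close>

type_synonym cell = "int \<times> int"
type_synonym block = "int \<times> int"

definition columns :: "nat \<Rightarrow> block \<Rightarrow> int set" where
  "columns k \<beta> = {fst \<beta> ..< fst \<beta> + int k}"

definition level :: "block \<Rightarrow> int" where
  "level \<beta> = snd \<beta>"

definition cells :: "nat \<Rightarrow> block \<Rightarrow> cell set" where
  "cells k \<beta> = columns k \<beta> \<times> {level \<beta>}"

definition is_tower :: "nat \<Rightarrow> nat \<Rightarrow> nat \<Rightarrow> block set \<Rightarrow> bool" where
  "is_tower k n b T \<longleftrightarrow>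
     finite T \<and> card T = n \<and>
     pairwise (\<lambda>\<beta> \<gamma>. disjnt (cells k \<beta>) (cells k \<gamma>)) T \<and>
     card {\<beta> \<in> T. level \<beta> = 0} = b \<and>
     (\<exists>a. (\<Union>\<beta> \<in> {\<beta> \<in> T. level \<beta> = 0}. cells k \<beta>) = {a ..< a + int (b * k)} \<times> {0}) \<and>
     (\<forall>\<beta> \<in> T. level \<beta> \<noteq> 0 \<longrightarrow>
        level \<beta> \<ge> 1 \<and>
        (\<exists>\<gamma> \<in> T. level \<gamma> = level \<beta> - 1 \<and> columns k \<gamma> \<inter> columns k \<beta> \<noteq> {}))"

definition translate :: "int \<Rightarrow> block set \<Rightarrow> block set" where
  "translate t T = (\<lambda>(x, y). (x + t, y)) ` T"

definition translation_rel :: "nat \<Rightarrow> nat \<Rightarrow> nat \<Rightarrow> (block set \<times> block set) set" where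
  "translation_rel k n b =
     {(S, T). is_tower k n b S \<and> is_tower k n b T \<and> (\<exists>t. T = translate t S)}"

definition towers :: "nat \<Rightarrow> nat \<Rightarrow> nat \<Rightarrow> block set set set" where
  "towers k n b = {T. is_tower k n b T} // translation_rel k n b"

lemma translate_0: "translate 0 T = T"
  by (simp add: translate_def)

lemma translate_translate: "translate s (translate t T) = translate (t + s) T"
  by (auto simp: translate_def image_image case_prod_unfold add.assoc)

lemma equiv_translation_rel: "equiv {T. is_tower k n b T} (translation_rel k n b)"
proof (rule equivI)
  show "translation_rel k n b \<subseteq> {T. is_tower k n b T} \<times> {T. is_tower k n b T}"
    by (auto simp: translation_rel_def)
  show "refl_on {T. is_tower k n b T} (translation_rel k n b)"
    by (auto simp: refl_on_def translation_rel_def) (metis translate_0)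
  show "sym (translation_rel k n b)"
  proof (rule symI)
    fix S T assume "(S, T) \<in> translation_rel k n b"
    then obtain t where st: "is_tower k n b S" "is_tower k n b T" and t: "T = translate t S"
      by (auto simp: translation_rel_def)
    have "translate (- t) T = S"
      unfolding t by (simp add: translate_translate translate_0)
    then have "\<exists>s. S = translate s T"
      by (intro exI[of _ "- t"]) (rule sym)
    with st show "(T, S) \<in> translation_rel k n b"
      by (simp add: translation_rel_def)
  qed
  show "trans (translation_rel k n b)"
    by (rule transI) (auto simp: translation_rel_def translate_translate)
qed

text \<open>
  Natural-number subtraction truncates, so the lower index is an integer here, with value \<open>0\<close>
  when it is negative.
\<close>

definition binom :: "nat \<Rightarrow> int \<Rightarrow> nat" where
  "binom m j = (if j < 0 then 0 else m choose nat j)"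

end

theory Submission imports Defs begin

text \<open>
  Let \<open>W(n, X)\<close> be the number of stacks of \<open>n\<close> blocks whose level-0 positions lie in a finite
  set \<open>X\<close>, and let \<open>N(S)\<close> be the set of positions overlapping a block at a position in \<open>S\<close>.
  Stripping the bottom level gives \<open>W(n, X) = (\<Sum>S. W(n - |S|, N(S)))\<close>, where \<open>S\<close> ranges over the
  layers contained in \<open>X\<close>. By induction on \<open>n\<close> this recursion implies
  \<open>W(n, Y \<union> A) = (\<Sum>S. W(n - |S|, N(S) \<union> A))\<close> for disjoint \<open>Y\<close> and \<open>A\<close>, where \<open>S\<close> ranges over the layers
  contained in \<open>Y\<close> only. In the language of heaps of pieces: the minimal pieces in \<open>Y\<close> may be
  removed while those in \<open>A\<close> drop down. The case \<open>Y = {x}\<close> is the Pascal-type recursion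
  \<open>W(n, X \<union> {x}) = W(n, X) + W(n - 1, N(x) \<union> X)\<close>.

  If \<open>X\<close> is an interval of length \<open>m \<ge> k - 1\<close> and \<open>x\<close> is the next integer, then \<open>N(x) \<union> X\<close> is an
  interval of length \<open>m + k\<close>, and the recursion is solved by \<open>W(n, X) = (kn + m - k) choose n\<close>.
  Its initial value at \<open>m = k - 1\<close> comes from shorter intervals, for which \<open>N(x) \<union> X = N(x)\<close>.
  Removing the base of a tower leaves a stack of \<open>n - b\<close> blocks over an interval of length
  \<open>bk + k - 1\<close>.
\<close>

section \<open>Stacks and their layers\<close>

definition spaced :: "nat \<Rightarrow> int set \<Rightarrow> bool" where
  "spaced k S \<longleftrightarrow> (\<forall>x\<in>S. \<forall>y\<in>S. x \<noteq> y \<longrightarrow> int k \<le> \<bar>x - y\<bar>)"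

definition near :: "nat \<Rightarrow> int set \<Rightarrow> int set" where
  "near k S = {x. \<exists>s\<in>S. \<bar>x - s\<bar> < int k}"

definition base :: "block set \<Rightarrow> int set" where
  "base T = {x. (x, 0) \<in> T}"

text \<open>Blocks enter only through their left ends: two on one level are disjoint when these are
  at least \<open>k\<close> apart, and one supports another on the next level when they are less
  than \<open>k\<close> apart. \<open>X\<close> only bounds the bottom level, so that it can be
  enlarged one position at a time.\<close>

definition stacks :: "nat \<Rightarrow> int set \<Rightarrow> nat \<Rightarrow> block set set" where
  "stacks k X n = {T. finite T \<and> card T = n \<and> base T \<subseteq> X \<and>
     (\<forall>x x' y. (x, y) \<in> T \<longrightarrow> (x', y) \<in> T \<longrightarrow> x \<noteq> x' \<longrightarrow> int k \<le> \<bar>x - x'\<bar>) \<and>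
     (\<forall>x y. (x, y) \<in> T \<longrightarrow> y = 0 \<or> y \<ge> 1 \<and> (\<exists>x'. (x', y - 1) \<in> T \<and> \<bar>x - x'\<bar> < int k))}"

definition add_layer :: "int set \<Rightarrow> block set \<Rightarrow> block set" where
  "add_layer S T = S \<times> {0} \<union> (\<lambda>(x, y). (x, y + 1)) ` T"

text \<open>The test \<open>y \<ge> 0\<close> discards the bottom level, which the shift would send
  to level -1.\<close>

definition drop_layer :: "block set \<Rightarrow> block set" where
  "drop_layer T = {(x, y). y \<ge> 0 \<and> (x, y + 1) \<in> T}"

lemma stacksD:
  assumes "T \<in> stacks k X n"
  shows "finite T" "card T = n" "base T \<subseteq> X"
    "(x, y) \<in> T \<Longrightarrow> (x', y) \<in> T \<Longrightarrow> x \<noteq> x' \<Longrightarrow> int k \<le> \<bar>x - x'\<bar>"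
    "(x, y) \<in> T \<Longrightarrow> 0 \<le> y"
    "(x, y) \<in> T \<Longrightarrow> y \<noteq> 0 \<Longrightarrow> \<exists>x'. (x', y - 1) \<in> T \<and> \<bar>x - x'\<bar> < int k"
  using assms unfolding stacks_def by fastforce+

lemma mem_add_layer:
  "(x, y) \<in> add_layer S T \<longleftrightarrow> x \<in> S \<and> y = 0 \<or> (x, y - 1) \<in> T"
  unfolding add_layer_def by (force simp: image_iff)

lemma mem_drop_layer: "(x, y) \<in> drop_layer T \<longleftrightarrow> y \<ge> 0 \<and> (x, y + 1) \<in> T"
  by (simp add: drop_layer_def)

lemma mem_base: "x \<in> base T \<longleftrightarrow> (x, 0) \<in> T"
  by (simp add: base_def)

text \<open>Following supports downwards from any block ends in a block at level 0.\<close>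

lemma base_empty_imp_empty:
  assumes T: "T \<in> stacks k X n" and "base T = {}"
  shows "T = {}"
proof -
  have "(x, y) \<notin> T" for x y
  proof (induction "nat y" arbitrary: x y rule: less_induct)
    case less
    show ?case
    proof
      assume xy: "(x, y) \<in> T"
      show False
      proof (cases "y = 0")
        case True
        with xy \<open>base T = {}\<close> show ?thesis by (auto simp: base_def)
      next
        case False
        with stacksD(5,6)[OF T xy] less[of "y - 1"] show ?thesis by auto
      qed
    qed
  qed
  then show ?thesis by auto
qed

lemma stacks_empty: "stacks k {} n = (if n = 0 then {{}} else {})"
proof -
  have "T = {}" if "T \<in> stacks k {} n" for T
    using base_empty_imp_empty[OF that] stacksD(3)[OF that] by simp
  moreover have "{} \<in> stacks k {} n \<longleftrightarrow> n = 0"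
    by (auto simp: stacks_def base_def)
  ultimately show ?thesis by auto
qed

lemma card_add_layer:
  assumes "finite S" "finite T" "\<And>x y. (x, y) \<in> T \<Longrightarrow> 0 \<le> y"
  shows "card (add_layer S T) = card S + card T"
proof -
  have "inj_on (\<lambda>(x, y). (x, y + 1 :: int)) T"
    by (auto simp: inj_on_def)
  moreover have "S \<times> {0} \<inter> (\<lambda>(x, y). (x, y + 1)) ` T = {}"
    using assms(3) by force
  ultimately show ?thesis
    unfolding add_layer_def using assms(1,2)
    by (simp add: card_Un_disjoint card_image card_cartesian_product)
qed

lemma base_spaced: "T \<in> stacks k X n \<Longrightarrow> spaced k (base T)"
  unfolding spaced_def using stacksD(4) by (simp add: mem_base)

lemma finite_base: "finite T \<Longrightarrow> finite (base T)"
  by (rule finite_surj[of T _ fst]) (force simp: base_def)+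

lemma card_base_le:
  assumes "T \<in> stacks k X n"
  shows "card (base T) \<le> n"
proof -
  have "base T \<subseteq> fst ` T" by (force simp: base_def)
  then have "card (base T) \<le> card T"
    using stacksD(1)[OF assms] by (meson card_image_le card_mono finite_imageI le_trans)
  then show ?thesis using stacksD(2)[OF assms] by simp
qed

text \<open>A block at level 1 is supported exactly when its position lies in
  \<open>near k S\<close>. Hence the support condition at level 1 turns into the base condition of
  the stack above the bottom layer, and all other conditions merely shift.\<close>

lemma add_layer_bij:
  assumes S: "finite S" "spaced k S" "S \<subseteq> X" "card S \<le> n"
  shows "bij_betw (add_layer S) (stacks k (near k S) (n - card S))
           {T \<in> stacks k X n. base T = S}"
proof (rule bij_betw_byWitness[where f' = drop_layer])
  show "\<forall>U\<in>stacks k (near k S) (n - card S). drop_layer (add_layer S U) = U"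
    using stacksD(5) by (fastforce simp: mem_add_layer mem_drop_layer)
  have *: "add_layer S (drop_layer T) = T" if "T \<in> stacks k X n" "base T = S" for T
  proof -
    have "(x, y) \<in> add_layer S (drop_layer T) \<longleftrightarrow> (x, y) \<in> T" for x y
      using stacksD(5)[OF that(1), of x y] that(2)
      by (cases "y = 0") (auto simp: mem_add_layer mem_drop_layer mem_base)
    then show ?thesis by auto
  qed
  then show "\<forall>T\<in>{T \<in> stacks k X n. base T = S}. add_layer S (drop_layer T) = T"
    by simp
  show "add_layer S ` stacks k (near k S) (n - card S) \<subseteq> {T \<in> stacks k X n. base T = S}"
  proof (rule image_subsetI)
    fix U assume U: "U \<in> stacks k (near k S) (n - card S)"
    have b: "base (add_layer S U) = S"
      using stacksD(5)[OF U] by (force simp: mem_base mem_add_layer)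
    have "card (add_layer S U) = n"
      using card_add_layer[of S U] S stacksD(1,2,5)[OF U] by simp
    moreover have "finite (add_layer S U)"
      using S(1) stacksD(1)[OF U] by (simp add: add_layer_def)
    moreover have "int k \<le> \<bar>x - x'\<bar>"
      if "(x, y) \<in> add_layer S U" "(x', y) \<in> add_layer S U" "x \<noteq> x'" for x x' y
      using that stacksD(4)[OF U, of x "y - 1" x'] stacksD(5)[OF U, of _ "y - 1"] S(2)
      by (force simp: mem_add_layer spaced_def)
    moreover have "y = 0 \<or> y \<ge> 1 \<and> (\<exists>x'. (x', y - 1) \<in> add_layer S U \<and> \<bar>x - x'\<bar> < int k)"
      if "(x, y) \<in> add_layer S U" for x y
    proof (cases "x \<in> S \<and> y = 0")
      case False
      then have xy: "(x, y - 1) \<in> U" using that by (auto simp: mem_add_layer)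
      \<comment> \<open>Blocks now at level 1 were the base of \<open>U\<close> and rest on
        \<open>S\<close>; higher blocks keep their support from \<open>U\<close>.\<close>
      show ?thesis
      proof (cases "y = 1")
        case True
        then have "x \<in> near k S"
          using xy stacksD(3)[OF U] by (auto simp: mem_base)
        then show ?thesis
          using True by (auto simp: near_def mem_add_layer)
      next
        case False
        then show ?thesis
          using stacksD(5)[OF U xy] stacksD(6)[OF U xy] by (auto simp: mem_add_layer)
      qed
    qed simp
    ultimately show "add_layer S U \<in> {T \<in> stacks k X n. base T = S}"
      using b S(3) unfolding stacks_def by blast
  qed
  show "drop_layer ` {T \<in> stacks k X n. base T = S} \<subseteq> stacks k (near k S) (n - card S)"
  proof (rule image_subsetI, clarify)
    fix T assume T: "T \<in> stacks k X n" and bT: "S = base T"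
    have nn: "0 \<le> y" if "(x, y) \<in> drop_layer T" for x y
      using that by (simp add: mem_drop_layer)
    have "finite ((\<lambda>(x, y). (x, y - 1)) ` T)"
      using stacksD(1)[OF T] by simp
    then have fin: "finite (drop_layer T)"
      by (rule rev_finite_subset) (force simp: drop_layer_def image_iff)
    have "card T = card S + card (drop_layer T)"
      using card_add_layer[OF S(1) fin nn] *[OF T] bT by simp
    then have "card (drop_layer T) = n - card S"
      using stacksD(2)[OF T] by simp
    moreover have "base (drop_layer T) \<subseteq> near k S"
      using stacksD(6)[OF T, of _ 1] bT by (fastforce simp: mem_base near_def mem_drop_layer)
    moreover have "int k \<le> \<bar>x - x'\<bar>"
      if "(x, y) \<in> drop_layer T" "(x', y) \<in> drop_layer T" "x \<noteq> x'" for x x' y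
      using that stacksD(4)[OF T, of x "y + 1" x'] by (simp add: mem_drop_layer)
    moreover have "y = 0 \<or> y \<ge> 1 \<and> (\<exists>x'. (x', y - 1) \<in> drop_layer T \<and> \<bar>x - x'\<bar> < int k)"
      if "(x, y) \<in> drop_layer T" for x y
      using that stacksD(6)[OF T, of x "y + 1"] by (force simp: mem_drop_layer)
    ultimately show "drop_layer T \<in> stacks k (near k (base T)) (n - card (base T))"
      using fin unfolding stacks_def bT by blast
  qed
qed

section \<open>Counting stacks\<close>

text \<open>These are the possible bottom layers of a stack of \<open>n\<close> blocks over
  \<open>X\<close>. The bound on the cardinality makes \<open>n - card S\<close> a true
  difference.\<close>

definition layers :: "nat \<Rightarrow> int set \<Rightarrow> nat \<Rightarrow> int set set" where
  "layers k X n = {S. S \<subseteq> X \<and> spaced k S \<and> card S \<le> n}"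

lemma finite_layers: "finite X \<Longrightarrow> finite (layers k X n)"
  by (rule finite_subset[of _ "Pow X"]) (auto simp: layers_def)

lemma stacks_eq_UN:
  "stacks k X n = (\<Union>S\<in>layers k X n. {T \<in> stacks k X n. base T = S})"
proof -
  have "base T \<in> layers k X n" if "T \<in> stacks k X n" for T
    using that stacksD(3) base_spaced card_base_le by (simp add: layers_def)
  then show ?thesis by blast
qed

lemma finite_near: "finite S \<Longrightarrow> finite (near k S)"
proof -
  assume "finite S"
  moreover have "near k S = (\<Union>s\<in>S. {s - int k<..<s + int k})"
    by (simp add: near_def abs_less_iff set_eq_iff) (smt (verit))
  ultimately show ?thesis by simp
qed

lemma near_empty [simp]: "near k {} = {}"
  by (simp add: near_def)

lemma near_Un: "near k (S \<union> R) = near k S \<union> near k R"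
  unfolding near_def by blast

text \<open>A nonempty base uses up blocks, so the induction on \<open>n\<close> covers what stands
  on it; an empty base leaves only the empty stack.\<close>

lemma finite_stacks: "finite X \<Longrightarrow> finite (stacks k X n)"
proof (induction n arbitrary: X rule: less_induct)
  case (less n)
  have "finite {T \<in> stacks k X n. base T = S}" if S: "S \<in> layers k X n" for S
  proof (cases "S = {}")
    case True
    show ?thesis
      by (rule finite_subset[of _ "{{}}"]) (use True base_empty_imp_empty in blast)+
  next
    case False
    have fS: "finite S" using S less.prems by (auto simp: layers_def intro: finite_subset)
    then have "0 < card S" "card S \<le> n"
      using False S by (auto simp: layers_def card_gt_0_iff)
    then have "n - card S < n" by simp
    then have "finite (stacks k (near k S) (n - card S))"
      using less.IH fS by (simp add: finite_near)
    then show ?thesis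
      using bij_betw_finite[OF add_layer_bij[OF fS]] S unfolding layers_def by blast
  qed
  then have "finite (\<Union>S\<in>layers k X n. {T \<in> stacks k X n. base T = S})"
    using finite_layers[OF less.prems] by blast
  then show ?case
    by (simp only: stacks_eq_UN[symmetric])
qed

lemma card_stacks_base:
  assumes "finite S" "spaced k S" "S \<subseteq> X" "card S \<le> n"
  shows "card {T \<in> stacks k X n. base T = S} = card (stacks k (near k S) (n - card S))"
  using bij_betw_same_card[OF add_layer_bij[OF assms]] by simp

lemma card_stacks_layers:
  assumes X: "finite X"
  shows "card (stacks k X n) =
    (\<Sum>S\<in>layers k X n. card (stacks k (near k S) (n - card S)))"
proof -
  have "card (\<Union>S\<in>layers k X n. {T \<in> stacks k X n. base T = S}) =
      (\<Sum>S\<in>layers k X n. card {T \<in> stacks k X n. base T = S})"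
    by (rule card_UN_disjoint) (auto simp: X finite_layers finite_stacks)
  then have "card (stacks k X n) = (\<Sum>S\<in>layers k X n. card {T \<in> stacks k X n. base T = S})"
    by (simp only: stacks_eq_UN[symmetric])
  also have "\<dots> = (\<Sum>S\<in>layers k X n. card (stacks k (near k S) (n - card S)))"
    using X by (intro sum.cong refl card_stacks_base) (auto simp: layers_def intro: finite_subset)
  finally show ?thesis .
qed

section \<open>Removing only some of the minimal blocks\<close>

lemma sum_layers_Un:
  assumes fin: "finite Y" "finite A" and disj: "Y \<inter> A = {}"
  shows "(\<Sum>Q\<in>layers k (Y \<union> A) n. f Q) =
    (\<Sum>S\<in>layers k Y n. \<Sum>R\<in>layers k (A - near k S) (n - card S). f (S \<union> R))"
proof -
  \<comment> \<open>A layer \<open>Q\<close> corresponds to its parts \<open>S\<close> in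
    \<open>Y\<close> and \<open>R\<close> in \<open>A\<close>. Spacing between the two parts says
    precisely that \<open>R\<close> avoids \<open>near k S\<close>.\<close>
  let ?Z = "SIGMA S:layers k Y n. layers k (A - near k S) (n - card S)"
  have card_Un: "card (S \<union> R) = card S + card R" if "S \<subseteq> Y" "R \<subseteq> A" for S R
    using that fin disj by (intro card_Un_disjoint) (auto intro: finite_subset)
  have "(\<Sum>Q\<in>layers k (Y \<union> A) n. f Q) = (\<Sum>(S, R)\<in>?Z. f (S \<union> R))"
  proof (rule sum.reindex_bij_witness[where i = "\<lambda>(S, R). S \<union> R" and j = "\<lambda>Q. (Q \<inter> Y, Q \<inter> A)"])
    fix Q assume Q: "Q \<in> layers k (Y \<union> A) n"
    then have QYA: "Q \<inter> Y \<union> Q \<inter> A = Q" by (auto simp: layers_def)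
    then show "(case (Q \<inter> Y, Q \<inter> A) of (S, R) \<Rightarrow> S \<union> R) = Q" by simp
    show "(case (Q \<inter> Y, Q \<inter> A) of (S, R) \<Rightarrow> f (S \<union> R)) = f Q" using QYA by simp
    have "card (Q \<inter> Y) + card (Q \<inter> A) \<le> n"
      using card_Un[of "Q \<inter> Y" "Q \<inter> A"] QYA Q by (simp add: layers_def)
    moreover have "spaced k (Q \<inter> Y)" "spaced k (Q \<inter> A)"
      using Q by (auto simp: layers_def spaced_def)
    moreover have "Q \<inter> A \<subseteq> A - near k (Q \<inter> Y)"
      using Q disj by (fastforce simp: layers_def spaced_def near_def)
    ultimately show "(Q \<inter> Y, Q \<inter> A) \<in> ?Z"
      by (auto simp: layers_def)
  next
    fix p assume p: "p \<in> ?Z"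
    obtain S R where SR: "p = (S, R)" by force
    have S: "S \<subseteq> Y" "spaced k S" "card S \<le> n"
      and R: "R \<subseteq> A" "R \<inter> near k S = {}" "spaced k R" "card R \<le> n - card S"
      using p SR by (auto simp: layers_def)
    show "((case p of (S, R) \<Rightarrow> S \<union> R) \<inter> Y, (case p of (S, R) \<Rightarrow> S \<union> R) \<inter> A) = p"
      using SR S R disj by auto
    have far: "int k \<le> \<bar>x - y\<bar>" if "x \<in> S" "y \<in> R" for x y
      using that R(2) by (force simp: near_def)
    have "spaced k (S \<union> R)"
      unfolding spaced_def
    proof (intro ballI impI)
      fix x y assume "x \<in> S \<union> R" "y \<in> S \<union> R" "x \<noteq> y"
      then show "int k \<le> \<bar>x - y\<bar>"
        using far[of x y] far[of y x] S(2) R(3) by (auto simp: spaced_def)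
    qed
    then show "(case p of (S, R) \<Rightarrow> S \<union> R) \<in> layers k (Y \<union> A) n"
      using SR S R card_Un[of S R] by (auto simp: layers_def)
  qed
  also have "\<dots> = (\<Sum>S\<in>layers k Y n. \<Sum>R\<in>layers k (A - near k S) (n - card S). f (S \<union> R))"
    using fin by (subst sum.Sigma) (auto simp: finite_layers)
  finally show ?thesis .
qed

text \<open>Expand the left side over all layers and split each as \<open>S \<union> R\<close>. For
  fixed nonempty \<open>S\<close>, the sum over \<open>R\<close> is the induction hypothesis read
  backwards, for the set \<open>near k S \<union> A\<close> cut into \<open>A - near k S\<close> (as
  \<open>Y\<close>) and \<open>near k S\<close> (as \<open>A\<close>).\<close>

lemma card_stacks_Un:
  assumes "finite Y" "finite A" "Y \<inter> A = {}"
  shows "card (stacks k (Y \<union> A) n) =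
    (\<Sum>S\<in>layers k Y n. card (stacks k (near k S \<union> A) (n - card S)))"
  using assms
proof (induction n arbitrary: Y A rule: less_induct)
  case (less n)
  let ?W = "\<lambda>X n. card (stacks k X n)"
  have "?W (Y \<union> A) n = (\<Sum>Q\<in>layers k (Y \<union> A) n. ?W (near k Q) (n - card Q))"
    using less.prems by (simp add: card_stacks_layers)
  also have "\<dots> = (\<Sum>S\<in>layers k Y n. \<Sum>R\<in>layers k (A - near k S) (n - card S).
      ?W (near k (S \<union> R)) (n - card (S \<union> R)))"
    using less.prems by (rule sum_layers_Un)
  also have "\<dots> = (\<Sum>S\<in>layers k Y n. ?W (near k S \<union> A) (n - card S))"
  proof (rule sum.cong[OF refl])
    fix S assume S: "S \<in> layers k Y n"
    then have fS: "finite S" using less.prems by (auto simp: layers_def intro: finite_subset)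
    have "(\<Sum>R\<in>layers k (A - near k S) (n - card S).
        ?W (near k (S \<union> R)) (n - card (S \<union> R))) =
      (\<Sum>R\<in>layers k (A - near k S) (n - card S).
        ?W (near k R \<union> near k S) (n - card S - card R))"
    proof (rule sum.cong[OF refl])
      fix R assume R: "R \<in> layers k (A - near k S) (n - card S)"
      have "card (S \<union> R) = card S + card R"
        using S R fS less.prems
        by (intro card_Un_disjoint) (auto simp: layers_def intro: finite_subset)
      then show "?W (near k (S \<union> R)) (n - card (S \<union> R)) =
          ?W (near k R \<union> near k S) (n - card S - card R)"
        by (simp add: near_Un Un_commute)
    qed
    also have "\<dots> = ?W (near k S \<union> A) (n - card S)"
    proof (cases "S = {}")
      case True
      then show ?thesis using less.prems by (simp add: card_stacks_layers)
    next
      case False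
      then have "0 < card S" "card S \<le> n" using S fS by (auto simp: layers_def card_gt_0_iff)
      then have "n - card S < n" by simp
      then have "?W ((A - near k S) \<union> near k S) (n - card S) =
        (\<Sum>R\<in>layers k (A - near k S) (n - card S).
          ?W (near k R \<union> near k S) (n - card S - card R))"
        using less.prems fS by (intro less.IH) (auto simp: finite_near)
      moreover have "(A - near k S) \<union> near k S = near k S \<union> A" by auto
      ultimately show ?thesis by simp
    qed
    finally show "(\<Sum>R\<in>layers k (A - near k S) (n - card S).
        ?W (near k (S \<union> R)) (n - card (S \<union> R))) = ?W (near k S \<union> A) (n - card S)" .
  qed
  finally show ?case .
qed

lemma card_stacks_insert:
  assumes X: "finite X" "x \<notin> X"
  shows "card (stacks k (insert x X) (Suc n)) =
    card (stacks k X (Suc n)) + card (stacks k (near k {x} \<union> X) n)"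
proof -
  have "layers k {x} (Suc n) = {{}, {x}}"
    by (auto simp: layers_def spaced_def subset_singleton_iff)
  then show ?thesis
    using card_stacks_Un[of "{x}" X k "Suc n"] X by simp
qed

lemma card_stacks_0: "card (stacks k X 0) = 1"
proof -
  have "stacks k X 0 = {{}}" by (auto simp: stacks_def base_def)
  then show ?thesis by simp
qed

section \<open>The binomial count over intervals\<close>

lemma near_singleton: "near k {x} = {x - int k + 1..<x + int k}"
  by (auto simp: near_def)

lemma card_stacks_interval:
  assumes k: "k \<ge> 1" and "m \<ge> k - 1"
  shows "card (stacks k {a..<a + int m} n) = (k * n + m - k) choose n"
  using assms(2)
proof (induction n arbitrary: a m)
  case 0
  \<comment> \<open>At \<open>m = k - 1\<close> the subtraction truncates, harmlessly, since the
    lower index is 0.\<close>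
  then show ?case by (simp add: card_stacks_0)
next
  case (Suc n)
  note IH = Suc.IH
  have ins: "{a..<a + int (Suc j)} = insert (a + int j) {a..<a + int j}" for j by auto
  \<comment> \<open>\<open>N\<close> is the upper index of the claim at
    \<open>m = k - 1\<close>.\<close>
  define N where "N = k * Suc n - 1"
  \<comment> \<open>While the interval has fewer than \<open>k\<close> positions, the neighbourhood
    of the next one contains it. So each new position contributes the same count, that of an
    interval of length \<open>2 * k - 1\<close>.\<close>
  have small: "card (stacks k {a..<a + int j} (Suc n)) = j * (N choose n)" if "j \<le> k - 1" for j
    using that
  proof (induction j)
    case 0
    then show ?case by (simp add: stacks_empty)
  next
    case (Suc j)
    have "near k {a + int j} \<union> {a..<a + int j} =
        {a + int j - int k + 1..<a + int j - int k + 1 + int (2 * k - 1)}"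
      using Suc.prems k by (auto simp: near_singleton)
    moreover have "k * n + (2 * k - 1) - k = N"
      using k by (simp add: N_def algebra_simps)
    ultimately have "card (stacks k (near k {a + int j} \<union> {a..<a + int j}) n) = N choose n"
      using IH[where m = "2 * k - 1" and a = "a + int j - int k + 1"] k by simp
    then show ?case
      unfolding ins using Suc k by (subst card_stacks_insert) auto
  qed
  \<comment> \<open>From length \<open>k - 1\<close> on, adding one position is Pascal's rule;
    \<open>j\<close> is the excess over \<open>k - 1\<close>.\<close>
  have "card (stacks k {a..<a + int (k - 1 + j)} (Suc n)) = (N + j) choose Suc n" for j
  proof (induction j)
    case 0
    have N: "N = n + (k - 1) * Suc n"
      using k by (cases k) (auto simp: N_def)
    \<comment> \<open>The value from \<open>small\<close> is \<open>(k - 1) * (N choose n)\<close>.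
      It equals \<open>N choose Suc n\<close> because
      \<open>N - n = (k - 1) * Suc n\<close>.\<close>
    have "Suc n * (N choose Suc n) = (N - n) * (N choose n)"
    proof (cases N)
      case (Suc N')
      then show ?thesis
        by (metis Suc_times_binomial binomial_absorb_comp diff_Suc_1)
    qed (simp add: not_less_eq_eq)
    also have "\<dots> = Suc n * ((k - 1) * (N choose n))"
      using N by (simp only: diff_add_inverse ac_simps)
    finally have "N choose Suc n = (k - 1) * (N choose n)"
      by (simp only: nat_mult_eq_cancel1 zero_less_Suc)
    then show ?case using small[of "k - 1"] by simp
  next
    case (Suc j)
    let ?x = "a + int (k - 1 + j)"
    \<comment> \<open>The neighbourhood starts at \<open>a + j\<close>, between \<open>a\<close> and
      \<open>?x\<close>, so the union has no gap.\<close>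
    have "near k {?x} \<union> {a..<?x} = {a..<a + int (2 * k - 1 + j)}"
      using k by (auto simp: near_singleton of_nat_diff)
    moreover have "k * n + (2 * k - 1 + j) - k = N + j"
      using k by (simp add: N_def algebra_simps)
    ultimately have "card (stacks k (near k {?x} \<union> {a..<?x}) n) = (N + j) choose n"
      using IH[where m = "2 * k - 1 + j" and a = a] k by simp
    moreover have "{a..<a + int (k - 1 + Suc j)} = insert ?x {a..<?x}" by auto
    ultimately show ?case
      using Suc k by (simp add: card_stacks_insert)
  qed
  from this[of "m - (k - 1)"] Suc.prems k show ?case
    by (simp add: N_def algebra_simps)
qed

section \<open>Towers\<close>

definition row :: "nat \<Rightarrow> nat \<Rightarrow> int \<Rightarrow> int set" where
  "row k b a = (\<lambda>i. a + int k * int i) ` {..<b}"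

lemma card_row: "k \<ge> 1 \<Longrightarrow> card (row k b a) = b"
  by (simp add: row_def card_image inj_on_def)

lemma finite_row: "finite (row k b a)"
  by (simp add: row_def)

lemma spaced_row: "spaced k (row k b a)"
proof -
  have "int k \<le> \<bar>int k * int i - int k * int j\<bar>" if "i \<noteq> j" for i j
  proof -
    have "int k * 1 \<le> int k * \<bar>int i - int j\<bar>"
      using that by (intro mult_left_mono) auto
    then show ?thesis
      by (simp add: abs_mult flip: right_diff_distrib)
  qed
  then show ?thesis by (auto simp: spaced_def row_def)
qed

lemma row_cover:
  assumes k: "k \<ge> 1"
  shows "(\<Union>x\<in>row k b a. {x..<x + int k}) = {a..<a + int (b * k)}"
proof (induction b)
  case 0
  then show ?case by (simp add: row_def)
next
  case (Suc b)
  have "row k (Suc b) a = insert (a + int k * int b) (row k b a)"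
    by (auto simp: row_def lessThan_Suc)
  then have "(\<Union>x\<in>row k (Suc b) a. {x..<x + int k}) =
      {a + int (b * k)..<a + int (b * k) + int k} \<union> {a..<a + int (b * k)}"
    using Suc by (simp add: mult.commute)
  also have "\<dots> = {a..<a + int (Suc b * k)}"
    by (simp add: algebra_simps Un_commute ivl_disj_un)
  finally show ?case .
qed

text \<open>The tiling is forced from left to right: the first cell must be a left end, and the
  block covering the cell just after a placed block cannot begin earlier, by spacing. This yields
  \<open>b\<close> members of \<open>B\<close>, hence all of it.\<close>

lemma cover_imp_row:
  assumes k: "k \<ge> 1" and fin: "finite B" and B: "spaced k B" "card B = b"
    and cover: "(\<Union>x\<in>B. {x..<x + int k}) = {a..<a + int (b * k)}"
  shows "B = row k b a"
proof -
  have "a + int k * int i \<in> B" if "i < b" for i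
    using that
  proof (induction i)
    case 0
    then have "a \<in> (\<Union>x\<in>B. {x..<x + int k})"
      using k cover by simp
    then obtain x where x: "x \<in> B" "x \<le> a" "a < x + int k" by auto
    have "x \<in> (\<Union>x\<in>B. {x..<x + int k})" using x k by auto
    then have "x \<ge> a" using cover by simp
    with x show ?case by simp
  next
    case (Suc i)
    let ?c = "a + int k * int i"
    have "int k * int (Suc i) < int k * int b"
      using Suc.prems k by (intro mult_strict_left_mono) auto
    then have "?c + int k \<in> {a..<a + int (b * k)}"
      by (simp add: algebra_simps)
    then obtain x where x: "x \<in> B" "x \<le> ?c + int k" "?c + int k < x + int k"
      unfolding cover[symmetric] by auto
    have "?c \<in> B" using Suc by simp
    then have "int k \<le> \<bar>x - ?c\<bar>"
      using B(1) x(1,3) unfolding spaced_def by fastforce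
    then have "x = ?c + int k" using x by simp
    then show ?case using x(1) by (simp add: algebra_simps)
  qed
  then have "row k b a \<subseteq> B" by (auto simp: row_def)
  then show ?thesis
    using card_subset_eq[OF fin, of "row k b a"] card_row[OF k] B(2) by simp
qed

section \<open>From cells to left ends\<close>

lemma runs_disjoint_iff:
  assumes "k \<ge> 1"
  shows "{x..<x + int k} \<inter> {x'..<x' + int k} = {} \<longleftrightarrow> int k \<le> \<bar>x - x'\<bar>"
  using assms by (simp add: min_def max_def) arith

lemma disjnt_cells_iff:
  assumes "k \<ge> 1"
  shows "disjnt (cells k (x, y)) (cells k (x', y')) \<longleftrightarrow> (y = y' \<longrightarrow> int k \<le> \<bar>x - x'\<bar>)"
  by (auto simp: disjnt_def cells_def columns_def level_def Times_Int_Times Sigma_empty_iff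
    runs_disjoint_iff[OF assms] simp del: Int_atLeastLessThan)

lemma columns_meet_iff:
  assumes "k \<ge> 1"
  shows "columns k (x', y') \<inter> columns k (x, y) \<noteq> {} \<longleftrightarrow> \<bar>x - x'\<bar> < int k"
  by (auto simp: columns_def runs_disjoint_iff[OF assms] abs_minus_commute
    simp del: Int_atLeastLessThan)

text \<open>Each geometric condition is rewritten in terms of left ends; by
  \<open>cover_imp_row\<close> and \<open>row_cover\<close>, a base of \<open>b\<close> spaced
  blocks fills a contiguous run exactly when it is a row.\<close>

lemma is_tower_iff:
  assumes k: "k \<ge> 1" and b: "b \<ge> 1"
  shows "is_tower k n b T \<longleftrightarrow> (\<exists>a. T \<in> stacks k (row k b a) n \<and> base T = row k b a)"
proof -
  have pw: "pairwise (\<lambda>\<beta> \<gamma>. disjnt (cells k \<beta>) (cells k \<gamma>)) T \<longleftrightarrow>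
      (\<forall>x x' y. (x, y) \<in> T \<longrightarrow> (x', y) \<in> T \<longrightarrow> x \<noteq> x' \<longrightarrow> int k \<le> \<bar>x - x'\<bar>)"
    by (fastforce simp: pairwise_def disjnt_cells_iff[OF k])
  have "(\<exists>\<gamma>\<in>T. level \<gamma> = y - 1 \<and> columns k \<gamma> \<inter> columns k (x, y) \<noteq> {}) \<longleftrightarrow>
      (\<exists>x'. (x', y - 1) \<in> T \<and> \<bar>x - x'\<bar> < int k)" for x y
    using columns_meet_iff[OF k, of _ "y - 1" x y]
    by (auto simp: Bex_def split_paired_Ex level_def simp del: Int_emptyI)
  then have sup: "(\<forall>\<beta> \<in> T. level \<beta> \<noteq> 0 \<longrightarrow> level \<beta> \<ge> 1 \<and>
        (\<exists>\<gamma> \<in> T. level \<gamma> = level \<beta> - 1 \<and> columns k \<gamma> \<inter> columns k \<beta> \<noteq> {})) \<longleftrightarrow>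
      (\<forall>x y. (x, y) \<in> T \<longrightarrow> y = 0 \<or> y \<ge> 1 \<and> (\<exists>x'. (x', y - 1) \<in> T \<and> \<bar>x - x'\<bar> < int k))"
    by (auto simp: Ball_def split_paired_All level_def)
  have b0: "{\<beta> \<in> T. level \<beta> = 0} = base T \<times> {0}"
    by (auto simp: level_def base_def)
  have "(\<Union>\<beta>\<in>base T \<times> {0}. cells k \<beta>) = (\<Union>x\<in>base T. {x..<x + int k}) \<times> {0}"
    by (auto simp: cells_def columns_def level_def)
  then have cover: "(\<Union>\<beta>\<in>base T \<times> {0}. cells k \<beta>) = {a..<a + int (b * k)} \<times> {0} \<longleftrightarrow>
      (\<Union>x\<in>base T. {x..<x + int k}) = {a..<a + int (b * k)}" for a
    by (simp only: times_eq_iff) blast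
  have tower: "is_tower k n b T \<longleftrightarrow> (\<exists>a. T \<in> stacks k (base T) n \<and> card (base T) = b \<and>
      (\<Union>x\<in>base T. {x..<x + int k}) = {a..<a + int (b * k)})"
    unfolding is_tower_def pw sup b0 cover stacks_def by (auto simp: card_cartesian_product)
  show ?thesis
  proof
    assume "is_tower k n b T"
    then obtain a where T: "T \<in> stacks k (base T) n" "card (base T) = b"
      and cov: "(\<Union>x\<in>base T. {x..<x + int k}) = {a..<a + int (b * k)}"
      using tower by blast
    have "base T = row k b a"
      using cover_imp_row[OF k _ base_spaced T(2) cov] T(1) stacksD(1) finite_base by blast
    then show "\<exists>a. T \<in> stacks k (row k b a) n \<and> base T = row k b a"
      using T(1) by metis
  next
    assume "\<exists>a. T \<in> stacks k (row k b a) n \<and> base T = row k b a"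
    then obtain a where "T \<in> stacks k (base T) n" "base T = row k b a" by auto
    then show "is_tower k n b T"
      unfolding tower using card_row[OF k] row_cover[OF k] by auto
  qed
qed

section \<open>Translation classes and their representatives\<close>

lemma mem_translate: "(x, y) \<in> translate t T \<longleftrightarrow> (x - t, y) \<in> T"
  by (force simp: translate_def)

lemma stacks_translate:
  assumes T: "T \<in> stacks k X n"
  shows "translate t T \<in> stacks k ((+) t ` X) n"
proof -
  have "card (translate t T) = n"
    unfolding translate_def using stacksD(2)[OF T]
    by (subst card_image) (auto simp: inj_on_def)
  moreover have "finite (translate t T)"
    using stacksD(1)[OF T] by (simp add: translate_def)
  moreover have "base (translate t T) \<subseteq> (+) t ` X"
    using stacksD(3)[OF T] by (force simp: mem_base mem_translate image_iff)
  moreover have "int k \<le> \<bar>x - x'\<bar>"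
    if "(x, y) \<in> translate t T" "(x', y) \<in> translate t T" "x \<noteq> x'" for x x' y
    using that stacksD(4)[OF T, of "x - t" y "x' - t"] by (simp add: mem_translate)
  moreover have "y = 0 \<or> y \<ge> 1 \<and> (\<exists>x'. (x', y - 1) \<in> translate t T \<and> \<bar>x - x'\<bar> < int k)"
    if xy: "(x, y) \<in> translate t T" for x y
  proof (cases "y = 0")
    case False
    have "(x - t, y) \<in> T" using xy by (simp add: mem_translate)
    from stacksD(5)[OF T this] stacksD(6)[OF T this False] obtain x' where
      "0 \<le> y" "(x', y - 1) \<in> T" "\<bar>x - t - x'\<bar> < int k" by blast
    then show ?thesis
      using False by (auto simp: mem_translate intro!: exI[of _ "x' + t"])
  qed simp
  ultimately show ?thesis unfolding stacks_def by blast
qed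

lemma base_translate: "base (translate t T) = (+) t ` base T"
  by (force simp: base_def mem_translate image_iff)

lemma row_translate: "(+) t ` row k b a = row k b (a + t)"
  by (auto simp: row_def image_image ac_simps)

lemma row_inj:
  assumes b: "b \<ge> 1" and eq: "row k b a = row k b a'"
  shows "a = a'"
proof -
  have Min: "Min (row k b c) = c" for c
  proof (rule Min_eqI)
    show "c \<in> row k b c"
      using b by (simp add: row_def image_iff) (rule bexI[of _ 0], simp_all)
  qed (auto simp: row_def)
  show ?thesis by (metis Min eq)
qed

text \<open>Every class has exactly one member whose base starts at 0: translating by
  \<open>- a\<close> produces it, and a further translation fixing the base row must be by
  0.\<close>

lemma towers_bij:
  assumes k: "k \<ge> 1" and b: "b \<ge> 1"
  shows "bij_betw (\<lambda>T. translation_rel k n b `` {T})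
    {T \<in> stacks k (row k b 0) n. base T = row k b 0} (towers k n b)"
    (is "bij_betw ?cls ?N _")
proof (rule bij_betw_imageI)
  note equiv = equiv_translation_rel[of k n b]
  have N: "is_tower k n b T" if "T \<in> ?N" for T
    using that is_tower_iff[OF k b] by blast
  show "inj_on ?cls ?N"
  proof (rule inj_onI)
    fix S T assume S: "S \<in> ?N" and T: "T \<in> ?N" and "?cls S = ?cls T"
    then have "(S, T) \<in> translation_rel k n b"
      using eq_equiv_class[OF _ equiv] N by blast
    then obtain t where t: "T = translate t S" by (auto simp: translation_rel_def)
    then have "row k b (0 + t) = row k b 0"
      using S T base_translate[of t S] row_translate[of t k b 0] by simp
    then have "t = 0" using row_inj[OF b] by fastforce
    then show "S = T" using t translate_0 by simp
  qed
  show "?cls ` ?N = towers k n b"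
  proof
    show "?cls ` ?N \<subseteq> towers k n b"
      using N by (auto simp: towers_def intro: quotientI)
    show "towers k n b \<subseteq> ?cls ` ?N"
    proof
      fix C assume "C \<in> towers k n b"
      then obtain T where T: "is_tower k n b T" and C: "C = ?cls T"
        by (auto simp: towers_def elim: quotientE)
      obtain a where a: "T \<in> stacks k (row k b a) n" "base T = row k b a"
        using T is_tower_iff[OF k b] by blast
      have "translate (- a) T \<in> ?N"
        using stacks_translate[OF a(1), of "- a"] base_translate[of "- a" T] a(2)
          row_translate[of "- a" k b a] by simp
      moreover have "(T, translate (- a) T) \<in> translation_rel k n b"
        using T N[OF calculation] by (auto simp: translation_rel_def)
      ultimately show "C \<in> ?cls ` ?N"
        unfolding C using equiv_class_eq[OF equiv] by blast
    qed
  qed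
qed

text \<open>A block at \<open>x\<close> overlaps the run of cells from 0 to \<open>b * k - 1\<close>
  exactly when \<open>x\<close> lies between \<open>1 - k\<close> and \<open>b * k - 1\<close>,
  which gives \<open>b * k + k - 1\<close> positions.\<close>

lemma near_row:
  assumes k: "k \<ge> 1" and b: "b \<ge> 1"
  shows "near k (row k b 0) = {1 - int k..<1 - int k + int (b * k + k - 1)}"
proof -
  have "x \<in> near k (row k b 0) \<longleftrightarrow> 1 - int k \<le> x \<and> x < int (b * k)" for x
  \<comment> \<open>For \<open>x \<ge> 0\<close> the base block covering cell \<open>x\<close> is
    the witness; for negative \<open>x\<close> it is the first base block, at 0.\<close>
  proof (cases "0 \<le> x")
    case True
    have "\<exists>s\<in>row k b 0. s \<le> x \<and> x < s + int k" if "x < int (b * k)"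
      using row_cover[OF k, of b 0] True that by (auto simp: set_eq_iff)
    moreover have "s + int k \<le> int (b * k)" if "s \<in> row k b 0" for s
    proof -
      have "{s..<s + int k} \<subseteq> {0..<int (b * k)}"
        using UN_upper[OF that, of "\<lambda>s. {s..<s + int k}"] row_cover[OF k, of b 0] by simp
      then show ?thesis using k by simp
    qed
    ultimately show ?thesis
      using True k unfolding near_def mem_Collect_eq by (smt (verit))
  next
    case False
    have "0 \<in> row k b 0"
      using b by (simp add: row_def image_iff) (rule bexI[of _ 0], simp_all)
    moreover have "0 \<le> s" if "s \<in> row k b 0" for s
      using that by (auto simp: row_def)
    moreover have "x < int (b * k)"
      using False by (simp add: less_le_trans[of x 0])
    ultimately show ?thesis
      using False unfolding near_def mem_Collect_eq by (smt (verit))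
  qed
  then show ?thesis using k by (auto simp: set_eq_iff of_nat_diff)
qed

theorem theorem3p2:
  fixes k n b :: nat
  assumes "k \<ge> 1" and "n \<ge> 1" and "b \<ge> 1"
  shows "finite (towers k n b) \<and>
    card (towers k n b) = binom (k * n - 1) (int n - int b)"
proof -
  let ?R = "row k b 0"
  let ?N = "{T \<in> stacks k ?R n. base T = ?R}"
  have bij: "bij_betw (\<lambda>T. translation_rel k n b `` {T}) ?N (towers k n b)"
    using assms by (intro towers_bij)
  have "finite ?N"
    using finite_stacks[OF finite_row] by simp
  then have "finite (towers k n b)"
    using bij bij_betw_finite by blast
  moreover have "card (towers k n b) = card ?N"
    using bij_betw_same_card[OF bij] by simp
  moreover have "card ?N = binom (k * n - 1) (int n - int b)"
  proof (cases "b \<le> n")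
    case True
    have "card ?N = card (stacks k (near k ?R) (n - b))"
      using card_stacks_base[OF finite_row spaced_row] card_row True assms(1) by simp
    also have "\<dots> = (k * (n - b) + (b * k + k - 1) - k) choose (n - b)"
      unfolding near_row[OF assms(1,3)] using assms(1) by (intro card_stacks_interval) auto
    also have "k * (n - b) + (b * k + k - 1) - k = k * n - 1"
    proof -
      have "k * (n - b) + b * k = k * n"
        using True by (metis add_mult_distrib2 le_add_diff_inverse2 mult.commute)
      then show ?thesis using assms(1) by simp
    qed
    finally show ?thesis
      using True by (simp add: binom_def nat_diff_distrib)
  next
    case False
    \<comment> \<open>A base of \<open>b\<close> blocks does not fit into \<open>n < b\<close>
      blocks, in agreement with the value 0 of \<open>binom\<close> at a negative lower
      index.\<close>
    then have "?N = {}"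
      using card_base_le card_row[OF assms(1)] by fastforce
    then have "card ?N = 0" by (simp only: card.empty)
    then show ?thesis
      using False by (simp add: binom_def)
  qed
  ultimately show ?thesis by simp
qed

end
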